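(* Let $k\ge1$, let $\beta_1,\ldots,\beta_k$ be negative real numbers, let $(\alpha_n)$ be a sequence of real numbers with $\alpha_n\to\infty$, and let $\mathbb{P}^{(n)}$ be the directed exponential random graph measure with outward-star parameters $\beta_p^{(n)}=\beta_p\alpha_n$, $p=1,\ldots,k$ (defined in the context). Assume that $\lim_{n\to\infty}ne^{\alpha_n\beta_1}=\lambda\in(0,\infty)$. Then for every fixed vertex $i$, $$\lim_{n\to\infty}\frac{\mathbb{P}^{(n)}(X_{1i}=1)}{\lambda n^{-1}}=1,$$ and for all fixed vertices $i\neq j$, $$\lim_{n\to\infty}\frac{\mathbb{P}^{(n)}(X_{1i}=1,\,X_{1j}=1)}{\lambda^2n^{-2}}=1.$$ Moreover, the (out-)degree of any vertex is asymptotically Poisson with parameter $\lambda$, i.e., under $\mathbb{P}^{(n)}$, $$\sum_{i=1}^nX_{1i}\to\mathrm{Poisson}(\lambda)$$ in distribution as $n\to\infty$ (and likewise with vertex $1$ replaced by any other fixed vertex).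
   Context: Directed graphs $G_n$ on the vertex set $\{1,\ldots,n\}$, with loops allowed, are represented by matrices $X_n=(X_{ij})_{1\le i,j\le n}$ with $X_{ij}\in\{0,1\}$, where $X_{ij}=1$ if and only if there is a directed edge from $i$ to $j$. For $p\ge1$ the directed $p$-star homomorphism density is $$s_p(X_n)=n^{-p-1}\sum_{1\le i,j_1,\ldots,j_p\le n}X_{ij_1}X_{ij_2}\cdots X_{ij_p}=n^{-p-1}\sum_{i=1}^n\left(\sum_{j=1}^nX_{ij}\right)^p.$$ The measure $\mathbb{P}^{(n)}$ on $\{0,1\}^{n\times n}$ is $$\mathbb{P}^{(n)}(G_n)=Z_n^{-1}\exp\left[n^2\sum_{p=1}^k\beta_p^{(n)}s_p(X_n)\right],\qquad \beta_p^{(n)}=\beta_p\alpha_n,$$ where $Z_n=\sum_{X_n\in\{0,1\}^{n\times n}}\exp\left[n^2\sum_{p=1}^k\beta_p^{(n)}s_p(X_n)\right]$. *)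

theory Defs
  imports "HOL-Probability.Probability"
begin

text \<open>
  A directed graph on the vertex set \<open>{1..n}\<close>, loops allowed, is given by its 0/1 matrix
  \<open>X\<close>, where \<open>X i j = 1\<close> iff there is an edge from \<open>i\<close> to \<open>j\<close>. Matrices are extensional, so
  that each graph has exactly one representation; entries with an index outside \<open>{1..n}\<close> are
  meaningless.
\<close>

definition digraphs :: "nat \<Rightarrow> (nat \<Rightarrow> nat \<Rightarrow> nat) set" where
  "digraphs n = {1..n} \<rightarrow>\<^sub>E {1..n} \<rightarrow>\<^sub>E {0, 1}"

definition out_degree :: "nat \<Rightarrow> (nat \<Rightarrow> nat \<Rightarrow> nat) \<Rightarrow> nat \<Rightarrow> nat" where
  "out_degree n X i = (\<Sum>j = 1..n. X i j)"

text \<open>The sum over \<open>j\<^sub>1, \<dots>, j\<^sub>p\<close> ranges over functions \<open>j\<close> from \<open>{1..p}\<close> to \<open>{1..n}\<close>.\<close>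

definition star_density :: "nat \<Rightarrow> nat \<Rightarrow> (nat \<Rightarrow> nat \<Rightarrow> nat) \<Rightarrow> real" where
  "star_density n p X =
     (\<Sum>i = 1..n. \<Sum>j \<in> {1..p} \<rightarrow>\<^sub>E {1..n}. \<Prod>q = 1..p. real (X i (j q))) / real n ^ (p + 1)"

lemma star_density_out_degree:
  "star_density n p X = (\<Sum>i = 1..n. real (out_degree n X i) ^ p) / real n ^ (p + 1)"
proof -
  have "(\<Sum>j \<in> {1..p} \<rightarrow>\<^sub>E {1..n}. \<Prod>q = 1..p. real (X i (j q))) = real (out_degree n X i) ^ p"
    for i
    using prod_sum_PiE[of "{1..p}" "\<lambda>_. {1..n}" "\<lambda>_ j. real (X i j)"]
    by (simp add: out_degree_def)
  then show ?thesis
    by (simp add: star_density_def)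
qed

definition ergm_weight :: "nat \<Rightarrow> nat \<Rightarrow> (nat \<Rightarrow> real) \<Rightarrow> (nat \<Rightarrow> nat \<Rightarrow> nat) \<Rightarrow> real" where
  "ergm_weight n k b X = exp (real n ^ 2 * (\<Sum>p = 1..k. b p * star_density n p X))"

definition ergm_Z :: "nat \<Rightarrow> nat \<Rightarrow> (nat \<Rightarrow> real) \<Rightarrow> real" where
  "ergm_Z n k b = (\<Sum>X \<in> digraphs n. ergm_weight n k b X)"

definition ergm :: "nat \<Rightarrow> nat \<Rightarrow> (nat \<Rightarrow> real) \<Rightarrow> (nat \<Rightarrow> nat \<Rightarrow> nat) pmf" where
  "ergm n k b =
     embed_pmf (\<lambda>X. if X \<in> digraphs n then ergm_weight n k b X / ergm_Z n k b else 0)"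

lemma finite_digraphs: "finite (digraphs n)"
  unfolding digraphs_def by (intro finite_PiE) auto

lemma digraphs_nonempty: "digraphs n \<noteq> {}"
  unfolding digraphs_def by (simp add: PiE_eq_empty_iff)

lemma ergm_Z_pos: "0 < ergm_Z n k b"
  unfolding ergm_Z_def ergm_weight_def
  by (intro sum_pos finite_digraphs digraphs_nonempty) simp

lemma pmf_ergm:
  "pmf (ergm n k b) X = (if X \<in> digraphs n then ergm_weight n k b X / ergm_Z n k b else 0)"
proof -
  let ?f = "\<lambda>X. if X \<in> digraphs n then ergm_weight n k b X / ergm_Z n k b else 0"
  have nonneg: "0 \<le> ?f X" for X
    using ergm_Z_pos[of n k b] by (simp add: ergm_weight_def)
  have "(\<integral>\<^sup>+X. ennreal (?f X) \<partial>count_space UNIV) = (\<Sum>X\<in>digraphs n. ennreal (?f X))"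
    by (rule nn_integral_count_space') (auto simp: finite_digraphs)
  also have "\<dots> = ennreal (\<Sum>X\<in>digraphs n. ?f X)"
    by (intro sum_ennreal) (rule nonneg)
  also have "(\<Sum>X\<in>digraphs n. ?f X) = 1"
    using ergm_Z_pos[of n k b] by (simp add: sum_divide_distrib[symmetric] ergm_Z_def)
  finally show ?thesis
    unfolding ergm_def using nonneg by (subst pmf_embed_pmf) auto
qed

end

theory Submission
  imports Defs "HOL-Real_Asymp.Real_Asymp"
begin

text \<open>
  The exponent of the weight splits over the rows of the matrix, so the rows are independent and
  the law of a row depends only on its sum. With \<open>w\<close> the weight of a row of given sum,
  prescribing \<open>m\<close> entries of a row to be \<open>1\<close> leaves the mass
  \<open>\<Sum>d. (n - m choose d) * w (d + m)\<close>, to be divided by the same sum for \<open>m = 0\<close>. The rate assumption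
  forces \<open>\<alpha> n = O(ln n)\<close>, hence the terms with \<open>p \<ge> 2\<close> vanish for fixed \<open>d\<close> and
  \<open>n ^ d * w d\<close> tends to \<open>lam ^ d\<close>; negativity of the parameters gives the domination
  \<open>n ^ d * w d \<le> (lam + 1) ^ d\<close>, and Tannery's theorem yields \<open>lam ^ m * exp lam\<close> as limit of
  \<open>n ^ m\<close> times the sum.
\<close>

section \<open>Factorisation of the graph weight over rows\<close>

definition row_weight :: "nat \<Rightarrow> nat \<Rightarrow> (nat \<Rightarrow> real) \<Rightarrow> nat \<Rightarrow> real" where
  "row_weight n k b d = exp (real n * (\<Sum>p = 1..k. b p * (real d / real n) ^ p))"

lemma row_weight_pos: "0 < row_weight n k b d"
  by (simp add: row_weight_def)

text \<open>Since \<open>n^2 * d^p / n^(p+1) = n * (d/n)^p\<close>, exchanging the sums over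
  \<open>p\<close> and over the vertices turns the exponent into a sum with one term per row. For
  \<open>n = 0\<close> both sides are 1.\<close>

lemma ergm_weight_eq_prod:
  "ergm_weight n k b X = (\<Prod>i = 1..n. row_weight n k b (out_degree n X i))"
proof (cases "n = 0")
  case False
  have "real n ^ 2 * (\<Sum>p = 1..k. b p * star_density n p X) =
      (\<Sum>p = 1..k. \<Sum>i = 1..n. real n * (b p * (real (out_degree n X i) / real n) ^ p))"
    using False
    by (simp add: star_density_out_degree sum_distrib_left sum_divide_distrib power_divide
        power2_eq_square)
  also have "\<dots> = (\<Sum>i = 1..n. real n * (\<Sum>p = 1..k. b p * (real (out_degree n X i) / real n) ^ p))"
    by (subst sum.swap) (simp add: sum_distrib_left)
  finally show ?thesis
    by (simp add: ergm_weight_def row_weight_def exp_sum)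
qed (simp add: ergm_weight_def)

section \<open>Sums over 0/1 rows as sums over subsets\<close>

lemma sum_PiE_01:
  fixes F :: "('a \<Rightarrow> nat) \<Rightarrow> 'b :: comm_monoid_add"
  shows "(\<Sum>x \<in> V \<rightarrow>\<^sub>E {0, 1}. F x) = (\<Sum>A\<in>Pow V. F (\<lambda>j\<in>V. of_bool (j \<in> A)))"
proof (rule sum.reindex_bij_witness[where j = "\<lambda>x. {j \<in> V. x j = 1}"
      and i = "\<lambda>A. \<lambda>j\<in>V. of_bool (j \<in> A)"])
  fix x :: "'a \<Rightarrow> nat"
  assume "x \<in> V \<rightarrow>\<^sub>E {0, 1}"
  then show *: "(\<lambda>j\<in>V. of_bool (j \<in> {j \<in> V. x j = 1})) = x"
    by (auto simp: fun_eq_iff PiE_iff extensional_def)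
  show "F (\<lambda>j\<in>V. of_bool (j \<in> {j \<in> V. x j = 1})) = F x"
    by (simp only: *)
qed (auto simp: PiE_iff)

lemma sum_Pow_card:
  fixes h :: "nat \<Rightarrow> real"
  assumes "finite T"
  shows "(\<Sum>A\<in>Pow T. h (card A)) = (\<Sum>d\<le>card T. real (card T choose d) * h d)"
proof -
  have "(\<Sum>A\<in>Pow T. h (card A)) = (\<Sum>d\<le>card T. \<Sum>A\<in>{A \<in> Pow T. card A = d}. h (card A))"
    using assms by (intro sum.group[symmetric]) (auto intro: card_mono)
  also have "\<dots> = (\<Sum>d\<le>card T. real (card T choose d) * h d)"
    using n_subsets[OF assms] by (intro sum.cong) auto
  finally show ?thesis .
qed

text \<open>A superset of \<open>S\<close> inside \<open>T\<close> is \<open>S\<close> together with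
  an arbitrary subset of \<open>T - S\<close>. The finite sum over \<open>d\<close> is written as a
  series, the binomial coefficient vanishing beyond \<open>card T - card S\<close>, because
  Tannery's theorem is later applied in this form.\<close>

lemma sum_supersets_card:
  fixes h :: "nat \<Rightarrow> real"
  assumes "finite T" "S \<subseteq> T"
  shows "(\<Sum>A\<in>{A \<in> Pow T. S \<subseteq> A}. h (card A)) =
    (\<Sum>d. real (card T - card S choose d) * h (d + card S))"
proof -
  have fin: "finite S" using assms finite_subset by blast
  have "(\<Sum>A\<in>{A \<in> Pow T. S \<subseteq> A}. h (card A)) = (\<Sum>A\<in>Pow (T - S). h (card A + card S))"
    by (rule sum.reindex_bij_witness[where j = "\<lambda>A. A - S" and i = "\<lambda>A. A \<union> S"])
      (use assms fin in \<open>auto simp: card_Diff_subset card_mono finite_subset\<close>)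
  also have "\<dots> = (\<Sum>d\<le>card T - card S. real (card T - card S choose d) * h (d + card S))"
    using sum_Pow_card[of "T - S" "\<lambda>d. h (d + card S)"] assms fin
    by (simp add: card_Diff_subset)
  also have "\<dots> = (\<Sum>d. real (card T - card S choose d) * h (d + card S))"
    by (rule suminf_finite[symmetric]) auto
  finally show ?thesis .
qed

section \<open>The law of a single row\<close>

definition row_sum :: "nat \<Rightarrow> nat \<Rightarrow> (nat \<Rightarrow> real) \<Rightarrow> nat \<Rightarrow> real" where
  "row_sum n k b m = (\<Sum>d. real (n - m choose d) * row_weight n k b (d + m))"

text \<open>Independence of the rows: the factors of all rows other than \<open>v\<close> appear in
  the numerator and in the normalising constant alike and cancel. A subset \<open>A\<close> stands
  for the row whose ones are at the positions in \<open>A\<close>.\<close>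

lemma prob_ergm_row:
  assumes v: "v \<in> {1..n}"
  shows "measure_pmf.prob (ergm n k b) {X. X v \<in> Q} =
    (\<Sum>A \<in> {A \<in> Pow {1..n}. (\<lambda>j\<in>{1..n}. of_bool (j \<in> A)) \<in> Q}. row_weight n k b (card A))
      / row_sum n k b 0"
proof -
  define R :: "(nat \<Rightarrow> nat) set" where "R = {1..n} \<rightarrow>\<^sub>E {0, 1}"
  define g :: "(nat \<Rightarrow> nat) \<Rightarrow> real" where "g x = row_weight n k b (\<Sum>j = 1..n. x j)" for x
  \<comment> \<open>The joint contribution of the other rows, which cancels in the end because it is
    positive.\<close>
  define C where "C = (\<Prod>i\<in>{1..n} - {v}. \<Sum>x\<in>R. g x)"
  have finR: "finite R" unfolding R_def by (intro finite_PiE) auto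
  have R0: "R \<noteq> {}" unfolding R_def by (simp add: PiE_eq_empty_iff)
  have "(\<Sum>x\<in>R. g x) > 0"
    using finR R0 by (intro sum_pos) (auto simp: g_def row_weight_pos)
  then have C: "C > 0" unfolding C_def by (intro prod_pos) auto
  have sumQ: "(\<Sum>X | X \<in> digraphs n \<and> X v \<in> Q. ergm_weight n k b X) = (\<Sum>x\<in>R \<inter> Q. g x) * C" for Q
  proof -
    \<comment> \<open>The condition on row \<open>v\<close> is absorbed into the factor of that row,
      so that the summand remains a product over rows and sum and product can be
      interchanged.\<close>
    define f where "f i x = (if i = v \<and> x \<notin> Q then 0 else g x)" for i x
    have "(\<Sum>X | X \<in> digraphs n \<and> X v \<in> Q. ergm_weight n k b X) =
        (\<Sum>X\<in>digraphs n. if X v \<in> Q then ergm_weight n k b X else 0)"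
      by (intro sum.mono_neutral_cong_left) (auto simp: finite_digraphs)
    also have "\<dots> = (\<Sum>X\<in>digraphs n. \<Prod>i = 1..n. f i (X i))"
    proof (rule sum.cong[OF refl])
      fix X
      show "(if X v \<in> Q then ergm_weight n k b X else 0) = (\<Prod>i = 1..n. f i (X i))"
      proof (cases "X v \<in> Q")
        case True
        then show ?thesis
          by (auto simp: ergm_weight_eq_prod f_def g_def out_degree_def intro!: prod.cong)
      next
        case False
        then have "(\<Prod>i = 1..n. f i (X i)) = 0"
          using v by (intro prod_zero) (auto simp: f_def)
        with False show ?thesis by simp
      qed
    qed
    also have "\<dots> = (\<Prod>i = 1..n. \<Sum>x\<in>R. f i x)"
      unfolding digraphs_def R_def[symmetric]
      by (rule prod_sum_PiE[symmetric]) (auto simp: finR)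
    also have "\<dots> = (\<Sum>x\<in>R. f v x) * (\<Prod>i\<in>{1..n} - {v}. \<Sum>x\<in>R. f i x)"
      using v by (intro prod.remove) auto
    also have "(\<Prod>i\<in>{1..n} - {v}. \<Sum>x\<in>R. f i x) = C"
      unfolding C_def by (intro prod.cong sum.cong) (auto simp: f_def)
    also have "(\<Sum>x\<in>R. f v x) = (\<Sum>x\<in>R \<inter> Q. g x)"
      by (intro sum.mono_neutral_cong_right) (auto simp: finR f_def)
    finally show ?thesis .
  qed
  have card_sum: "(\<Sum>j = 1..n. (\<lambda>j\<in>{1..n}. of_bool (j \<in> A)) j) = card A" if "A \<subseteq> {1..n}"
    for A :: "nat set"
  proof -
    have "(\<Sum>j = 1..n. (\<lambda>j\<in>{1..n}. of_bool (j \<in> A)) j) = (\<Sum>j = 1..n. of_bool (j \<in> A) :: nat)"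
      by (intro sum.cong) auto
    also have "\<dots> = card A"
      using that by (simp add: of_bool_def sum.If_cases Int_absorb1)
    finally show ?thesis .
  qed
  have sumR: "(\<Sum>x\<in>R \<inter> Q. g x) =
      (\<Sum>A \<in> {A \<in> Pow {1..n}. (\<lambda>j\<in>{1..n}. of_bool (j \<in> A)) \<in> Q}. row_weight n k b (card A))" for Q
  proof -
    have "(\<Sum>x\<in>R \<inter> Q. g x) = (\<Sum>x\<in>R. if x \<in> Q then g x else 0)"
      using finR by (simp add: sum.inter_restrict)
    also have "\<dots> = (\<Sum>A\<in>Pow {1..n}. if (\<lambda>j\<in>{1..n}. of_bool (j \<in> A)) \<in> Q
        then row_weight n k b (card A) else 0)"
      unfolding R_def sum_PiE_01 g_def using card_sum by (intro sum.cong) auto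
    also have "\<dots> = (\<Sum>A \<in> {A \<in> Pow {1..n}. (\<lambda>j\<in>{1..n}. of_bool (j \<in> A)) \<in> Q}.
        row_weight n k b (card A))"
      by (rule sum.inter_filter[symmetric]) simp
    finally show ?thesis .
  qed
  \<comment> \<open>The case \<open>Q = UNIV\<close> identifies the partition function as the total
    weight of one row times \<open>C\<close>.\<close>
  have "row_sum n k b 0 = (\<Sum>x\<in>R \<inter> UNIV. g x)"
    using sum_supersets_card[of "{1..n}" "{}" "row_weight n k b"]
    by (simp only: sumR) (simp add: row_sum_def)
  then have Z: "ergm_Z n k b = row_sum n k b 0 * C"
    using sumQ[of UNIV] by (simp add: ergm_Z_def)
  \<comment> \<open>Restricting to the support loses no mass and makes the event finite, so its
    probability is a sum of point masses.\<close>
  have "measure_pmf.prob (ergm n k b) {X. X v \<in> Q} =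
      measure_pmf.prob (ergm n k b) {X. X \<in> digraphs n \<and> X v \<in> Q}"
    by (intro measure_pmf.finite_measure_eq_AE)
      (auto simp: AE_measure_pmf_iff set_pmf_eq pmf_ergm split: if_splits)
  also have "\<dots> = (\<Sum>X | X \<in> digraphs n \<and> X v \<in> Q. pmf (ergm n k b) X)"
    by (rule measure_measure_pmf_finite) (simp add: finite_digraphs)
  also have "\<dots> = (\<Sum>X | X \<in> digraphs n \<and> X v \<in> Q. ergm_weight n k b X) / ergm_Z n k b"
    by (simp add: pmf_ergm sum_divide_distrib)
  also have "\<dots> = (\<Sum>x\<in>R \<inter> Q. g x) / row_sum n k b 0"
    using C by (simp add: sumQ Z)
  finally show ?thesis
    by (simp only: sumR)
qed

text \<open>The rows with ones on all of \<open>S\<close> correspond to the supersets of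
  \<open>S\<close>, whose total weight is a \<open>row_sum\<close>.\<close>

lemma prob_ergm_edges:
  assumes "v \<in> {1..n}" "S \<subseteq> {1..n}"
  shows "measure_pmf.prob (ergm n k b) {X. \<forall>j\<in>S. X v j = 1} =
    row_sum n k b (card S) / row_sum n k b 0"
proof -
  have *: "{A \<in> Pow {1..n}. (\<lambda>j\<in>{1..n}. of_bool (j \<in> A)) \<in> {x. \<forall>j\<in>S. x j = (1::nat)}} =
      {A \<in> Pow {1..n}. S \<subseteq> A}"
  proof -
    have "(\<forall>j\<in>S. (\<lambda>j\<in>{1..n}. of_bool (j \<in> A)) j = (1::nat)) \<longleftrightarrow> S \<subseteq> A" for A
      unfolding subset_iff Ball_def using assms(2) by (intro all_cong1) auto
    then show ?thesis by blast
  qed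
  show ?thesis
    using prob_ergm_row[OF assms(1), of k b "{x. \<forall>j\<in>S. x j = 1}"]
      sum_supersets_card[of "{1..n}" S "row_weight n k b"] assms(2)
    unfolding * by (simp add: row_sum_def)
qed

lemma prob_ergm_out_degree:
  assumes "v \<in> {1..n}"
  shows "measure_pmf.prob (ergm n k b) {X. out_degree n X v = d} =
    real (n choose d) * row_weight n k b d / row_sum n k b 0"
proof -
  have *: "{A \<in> Pow {1..n}. (\<lambda>j\<in>{1..n}. of_bool (j \<in> A)) \<in> {x. (\<Sum>j = 1..n. x j) = d}} =
      {A. A \<subseteq> {1..n} \<and> card A = d}"
    by (auto simp: of_bool_def sum.If_cases Int_absorb1)
  have "(\<Sum>A | A \<subseteq> {1..n} \<and> card A = d. row_weight n k b (card A)) =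
      real (n choose d) * row_weight n k b d"
    using n_subsets[of "{1..n}" d] by simp
  then show ?thesis
    using prob_ergm_row[OF assms, of k b "{x. (\<Sum>j = 1..n. x j) = d}"]
    unfolding * by (simp add: out_degree_def)
qed

section \<open>Limits and bounds for the individual terms\<close>

lemma tendsto_diff_choose:
  "(\<lambda>n. real (n - m choose d) / real n ^ d) \<longlonglongrightarrow> 1 / fact d"
proof -
  have "(\<lambda>n. (real n - real m - real i) / real n) \<longlonglongrightarrow> 1" for i
    by real_asymp
  then have "(\<lambda>n. (\<Prod>i = 0..<d. (real n - real m - real i) / real n) / fact d)
      \<longlonglongrightarrow> (\<Prod>i = 0..<d. 1) / fact d"
    by (intro tendsto_intros) auto
  moreover have "eventually (\<lambda>n. (\<Prod>i = 0..<d. (real n - real m - real i) / real n) / fact d =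
      real (n - m choose d) / real n ^ d) sequentially"
    using eventually_ge_at_top[of m]
  proof eventually_elim
    case (elim n)
    \<comment> \<open>The falling factorial is taken over the reals, where no factor is truncated;
      \<open>n \<ge> m\<close> is what makes the natural subtraction \<open>n - m\<close> agree with
      the real one.\<close>
    have *: "fact d * real (n - m choose d) = (\<Prod>i = 0..<d. real n - real m - real i)"
      using gbinomial_mult_fact[where 'a = real, of d "real (n - m)"] elim
      by (simp add: binomial_gbinomial of_nat_diff)
    then show ?case
      unfolding prod_dividef by (simp flip: *)
  qed
  ultimately show ?thesis
    by (auto intro: Lim_transform_eventually)
qed

text \<open>The term \<open>p = 1\<close> of the exponent equals
  \<open>d * (\<alpha> n * \<beta> 1)\<close> and combines with \<open>n ^ d\<close> into a power of
  the rate. A term with \<open>p \<ge> 2\<close> equals \<open>\<alpha> n / n\<close> times a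
  bounded quantity and vanishes.\<close>

lemma row_weight_limit:
  assumes "k \<ge> 1"
    and rate: "(\<lambda>n. real n * exp (\<alpha> n * \<beta> 1)) \<longlonglongrightarrow> lam"
    and sublinear: "(\<lambda>n. \<alpha> n / real n) \<longlonglongrightarrow> 0"
  shows "(\<lambda>n. real n ^ d * row_weight n k (\<lambda>p. \<beta> p * \<alpha> n) d) \<longlonglongrightarrow> lam ^ d"
proof -
  have "(\<lambda>n. \<alpha> n / real n * (\<beta> p * real d ^ p * inverse (real n) ^ (p - 2))) \<longlonglongrightarrow> 0" for p
  proof -
    \<comment> \<open>For \<open>p = 2\<close> the last factor is constantly 1, so the decay has to
      come from \<open>\<alpha> n / n\<close>.\<close>
    have "(\<lambda>n. \<alpha> n / real n * (\<beta> p * real d ^ p * inverse (real n) ^ (p - 2)))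
        \<longlonglongrightarrow> 0 * (\<beta> p * real d ^ p * 0 ^ (p - 2))"
      by (intro tendsto_intros sublinear lim_inverse_n)
    then show ?thesis by simp
  qed
  then have "(\<lambda>n. (real n * exp (\<alpha> n * \<beta> 1)) ^ d *
      exp (\<Sum>p = 2..k. \<alpha> n / real n * (\<beta> p * real d ^ p * inverse (real n) ^ (p - 2))))
      \<longlonglongrightarrow> lam ^ d * exp (\<Sum>p = 2..k. 0)"
    by (intro tendsto_intros rate)
  moreover have "eventually (\<lambda>n. (real n * exp (\<alpha> n * \<beta> 1)) ^ d *
      exp (\<Sum>p = 2..k. \<alpha> n / real n * (\<beta> p * real d ^ p * inverse (real n) ^ (p - 2))) =
      real n ^ d * row_weight n k (\<lambda>p. \<beta> p * \<alpha> n) d) sequentially"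
    using eventually_gt_at_top[of 0]
  proof eventually_elim
    case (elim n)
    have "real n * (\<Sum>p = 1..k. \<beta> p * \<alpha> n * (real d / real n) ^ p) =
        (\<Sum>p = 1..k. real n * (\<beta> p * \<alpha> n * (real d / real n) ^ p))"
      by (rule sum_distrib_left)
    also have "\<dots> = real d * (\<alpha> n * \<beta> 1) +
        (\<Sum>p = 2..k. real n * (\<beta> p * \<alpha> n * (real d / real n) ^ p))"
      using \<open>k \<ge> 1\<close> elim by (subst sum.atLeast_Suc_atMost) (auto simp: numeral_2_eq_2)
    also have "(\<Sum>p = 2..k. real n * (\<beta> p * \<alpha> n * (real d / real n) ^ p)) =
        (\<Sum>p = 2..k. \<alpha> n / real n * (\<beta> p * real d ^ p * inverse (real n) ^ (p - 2)))"
    proof (rule sum.cong[OF refl])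
      fix p assume "p \<in> {2..k}"
      then obtain q where p: "p = q + 2"
        by (metis atLeastAtMost_iff add.commute le_Suc_ex)
      show "real n * (\<beta> p * \<alpha> n * (real d / real n) ^ p) =
          \<alpha> n / real n * (\<beta> p * real d ^ p * inverse (real n) ^ (p - 2))"
        using elim by (simp add: p field_simps power_divide)
    qed
    finally show ?case
      by (simp add: row_weight_def exp_add exp_of_nat_mult power_mult_distrib)
  qed
  ultimately show ?thesis
    by (auto intro: Lim_transform_eventually)
qed

text \<open>The terms with \<open>p \<ge> 2\<close> are nonpositive, so dropping them only increases
  the exponent. The bound holds for every \<open>d\<close> at once, as domination requires.\<close>

lemma row_weight_le:
  assumes "k \<ge> 1" "n > 0" "\<alpha> n \<ge> 0" "\<And>p. p \<in> {1..k} \<Longrightarrow> \<beta> p \<le> 0"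
  shows "row_weight n k (\<lambda>p. \<beta> p * \<alpha> n) d \<le> exp (\<alpha> n * \<beta> 1) ^ d"
proof -
  have "(\<Sum>p = 1..k. \<beta> p * \<alpha> n * (real d / real n) ^ p) =
      \<beta> 1 * \<alpha> n * (real d / real n) + (\<Sum>p = 2..k. \<beta> p * \<alpha> n * (real d / real n) ^ p)"
    using \<open>k \<ge> 1\<close> by (subst sum.atLeast_Suc_atMost) (auto simp: numeral_2_eq_2)
  moreover have "(\<Sum>p = 2..k. \<beta> p * \<alpha> n * (real d / real n) ^ p) \<le> 0"
    using assms by (intro sum_nonpos mult_nonpos_nonneg) auto
  ultimately have "real n * (\<Sum>p = 1..k. \<beta> p * \<alpha> n * (real d / real n) ^ p) \<le>
      real n * (\<beta> 1 * \<alpha> n * (real d / real n))"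
    by (intro mult_left_mono) auto
  also have "\<dots> = real d * (\<alpha> n * \<beta> 1)"
    using \<open>n > 0\<close> by simp
  finally show ?thesis
    by (simp add: row_weight_def flip: exp_of_nat_mult)
qed

section \<open>The limit of the row sums by dominated convergence\<close>

lemma row_sum_limit:
  assumes "k \<ge> 1" and "lam > 0" and neg: "\<And>p. p \<in> {1..k} \<Longrightarrow> \<beta> p < 0"
    and top: "filterlim \<alpha> at_top sequentially"
    and rate: "(\<lambda>n. real n * exp (\<alpha> n * \<beta> 1)) \<longlonglongrightarrow> lam"
    and sublinear: "(\<lambda>n. \<alpha> n / real n) \<longlonglongrightarrow> 0"
  shows "(\<lambda>n. real n ^ m * row_sum n k (\<lambda>p. \<beta> p * \<alpha> n) m) \<longlonglongrightarrow> lam ^ m * exp lam"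
proof -
  define w where "w n d = row_weight n k (\<lambda>p. \<beta> p * \<alpha> n) d" for n d
  \<comment> \<open>The factor \<open>n ^ m\<close> is split as \<open>n ^ (d + m) / n ^ d\<close>:
    one power normalises the weight, the other the binomial coefficient, and each factor gets its
    own limit and bound.\<close>
  define a where "a d n = real (n - m choose d) / real n ^ d * (real n ^ (d + m) * w n (d + m))"
    for d n
  have exp_series: "(\<lambda>d. 1 / fact d * x ^ (d + m)) sums (x ^ m * exp x)" for x :: real
    using sums_mult[OF exp_converges[of x], of "x ^ m"]
    by (simp add: power_add field_simps)
  have limit: "(\<lambda>n. a d n) \<longlonglongrightarrow> 1 / fact d * lam ^ (d + m)" for d
    unfolding a_def w_def
    by (intro tendsto_mult tendsto_diff_choose row_weight_limit assms)
  \<comment> \<open>As \<open>lam + 1\<close> exceeds the limit,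
    \<open>n * exp (\<alpha> n * \<beta> 1)\<close> is eventually below it, from a threshold on that
    does not depend on \<open>d\<close>. The resulting bounds form a convergent exponential
    series.\<close>
  have dominated: "eventually (\<lambda>n. \<forall>d. norm (a d n) \<le> 1 / fact d * (lam + 1) ^ (d + m)) sequentially"
    using eventually_gt_at_top[of 0] order_tendstoD(2)[OF rate, of "lam + 1", simplified]
      filterlim_at_top[THEN iffD1, OF top, rule_format, of 0]
  proof eventually_elim
    case (elim n)
    show ?case
    proof
      fix d
      have "(n - m choose d) \<le> (n choose d)"
        by (rule binomial_right_mono) simp
      then have "fact d * (n - m choose d) \<le> n ^ d"
        using binomial_fact_pow[of n d] by (metis mult.commute mult_le_mono1 le_trans)
      then have "fact d * real (n - m choose d) \<le> real n ^ d"
        by (metis of_nat_fact of_nat_le_iff of_nat_mult of_nat_power)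
      then have 1: "real (n - m choose d) / real n ^ d \<le> 1 / fact d"
        using elim by (simp add: field_simps)
      have "real n ^ (d + m) * w n (d + m) \<le> real n ^ (d + m) * exp (\<alpha> n * \<beta> 1) ^ (d + m)"
        unfolding w_def using elim assms(1) neg
        by (intro mult_left_mono row_weight_le) (auto intro: less_imp_le)
      also have "\<dots> \<le> (lam + 1) ^ (d + m)"
        using elim by (subst power_mult_distrib[symmetric]) (intro power_mono; simp)
      finally have 2: "real n ^ (d + m) * w n (d + m) \<le> (lam + 1) ^ (d + m)" .
      have "0 \<le> w n (d + m)"
        by (simp add: w_def row_weight_pos less_imp_le)
      then have "norm (a d n) = a d n"
        by (simp add: a_def)
      also have "\<dots> \<le> 1 / fact d * (lam + 1) ^ (d + m)"
        unfolding a_def by (rule mult_mono[OF 1 2]) (use \<open>0 \<le> w n (d + m)\<close> in simp_all)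
      finally show "norm (a d n) \<le> 1 / fact d * (lam + 1) ^ (d + m)" .
    qed
  qed
  \<comment> \<open>Tannery's theorem asks for the bound along the product filter; here it holds for
    every \<open>d\<close> once \<open>n\<close> is large.\<close>
  have "eventually (\<lambda>(d, n). norm (a d n) \<le> 1 / fact d * (lam + 1) ^ (d + m))
      (at_top \<times>\<^sub>F sequentially)"
    by (rule eventually_mono[OF eventually_prodI[OF eventually_True dominated]]) auto
  from tannerys_theorem[where a = a, OF limit this]
  have "(\<lambda>n. \<Sum>d. a d n) \<longlonglongrightarrow> (\<Sum>d. 1 / fact d * lam ^ (d + m))"
    using exp_series[of "lam + 1"] by (simp add: sums_iff)
  moreover have "(\<Sum>d. 1 / fact d * lam ^ (d + m)) = lam ^ m * exp lam"
    using exp_series[of lam] by (simp add: sums_iff)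
  moreover have "eventually (\<lambda>n. (\<Sum>d. a d n) =
      real n ^ m * row_sum n k (\<lambda>p. \<beta> p * \<alpha> n) m) sequentially"
    using eventually_gt_at_top[of 0]
  proof eventually_elim
    case (elim n)
    have "summable (\<lambda>d. real (n - m choose d) * w n (d + m))"
      by (rule summable_finite[of "{..n}"]) auto
    from suminf_mult[OF this, of "real n ^ m"] show ?case
      using elim by (simp add: row_sum_def a_def w_def power_add field_simps)
  qed
  ultimately show ?thesis
    by (auto intro: Lim_transform_eventually)
qed

text \<open>Taking logarithms, \<open>ln n + \<alpha> n * b\<close> converges to
  \<open>ln lam\<close>. Dividing by \<open>n\<close> leaves \<open>\<alpha> n * b / n\<close> with
  limit 0, because \<open>ln n / n\<close> tends to 0.\<close>

lemma sublinear_of_exp_rate: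
  fixes \<alpha> :: "nat \<Rightarrow> real"
  assumes "b \<noteq> 0" "lam > 0" and rate: "(\<lambda>n. real n * exp (\<alpha> n * b)) \<longlonglongrightarrow> lam"
  shows "(\<lambda>n. \<alpha> n / real n) \<longlonglongrightarrow> 0"
proof -
  have "(\<lambda>n. (ln (real n * exp (\<alpha> n * b)) * inverse (real n) - ln (real n) / real n) / b)
      \<longlonglongrightarrow> (ln lam * 0 - 0) / b"
    using assms by (intro tendsto_intros rate lim_inverse_n lim_ln_over_n) auto
  moreover have "eventually (\<lambda>n. (ln (real n * exp (\<alpha> n * b)) * inverse (real n) -
      ln (real n) / real n) / b = \<alpha> n / real n) sequentially"
    using eventually_gt_at_top[of 0]
    by eventually_elim (use \<open>b \<noteq> 0\<close> in \<open>simp add: ln_mult field_simps\<close>)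
  ultimately show ?thesis
    by (auto intro: Lim_transform_eventually)
qed

section \<open>Edge probabilities and the Poisson limit of the degree\<close>

theorem theorem3p3:
  fixes k :: nat and \<beta> :: "nat \<Rightarrow> real" and \<alpha> :: "nat \<Rightarrow> real" and lam :: real
    and P :: "nat \<Rightarrow> (nat \<Rightarrow> nat \<Rightarrow> nat) pmf"
  defines "P \<equiv> \<lambda>n. ergm n k (\<lambda>p. \<beta> p * \<alpha> n)"
  assumes "k \<ge> 1"
    and "\<forall>p\<in>{1..k}. \<beta> p < 0"
    and "filterlim \<alpha> at_top sequentially"
    and "lam > 0"
    and "(\<lambda>n. real n * exp (\<alpha> n * \<beta> 1)) \<longlonglongrightarrow> lam"
  shows "(\<forall>i\<ge>1.
           (\<lambda>n. measure_pmf.prob (P n) {X. X 1 i = 1} / (lam * inverse (real n))) \<longlonglongrightarrow> 1)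
       \<and> (\<forall>i\<ge>1. \<forall>j\<ge>1. i \<noteq> j \<longrightarrow>
           (\<lambda>n. measure_pmf.prob (P n) {X. X 1 i = 1 \<and> X 1 j = 1}
                  / (lam ^ 2 * inverse (real n) ^ 2)) \<longlonglongrightarrow> 1)
       \<and> (\<forall>v\<ge>1.
           weak_conv_m (\<lambda>n. distr (measure_pmf (P n)) borel (\<lambda>X. real (out_degree n X v)))
             (distr (measure_pmf (poisson_pmf lam)) borel real))"
proof -
  let ?b = "\<lambda>n p. \<beta> p * \<alpha> n"
  have "\<beta> 1 \<noteq> 0"
    using assms(2,3) by force
  then have sublinear: "(\<lambda>n. \<alpha> n / real n) \<longlonglongrightarrow> 0"
    using assms(5,6) by (intro sublinear_of_exp_rate)
  have row_sum: "(\<lambda>n. real n ^ m * row_sum n k (?b n) m) \<longlonglongrightarrow> lam ^ m * exp lam" for m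
    using assms sublinear by (intro row_sum_limit) auto
  from row_sum[of 0] have row_sum0: "(\<lambda>n. row_sum n k (?b n) 0) \<longlonglongrightarrow> exp lam"
    by simp
  \<comment> \<open>Stated for a finite set \<open>S\<close> of targets, this yields both edge
    claims, with \<open>S\<close> of one and of two elements. Vertices are numbered from 1, hence
    \<open>0 \<notin> S\<close>.\<close>
  have edges: "(\<lambda>n. measure_pmf.prob (P n) {X. \<forall>j\<in>S. X 1 j = 1}
      / (lam ^ card S * inverse (real n) ^ card S)) \<longlonglongrightarrow> 1"
    if "finite S" "0 \<notin> S" for S
  proof -
    have "(\<lambda>n. real n ^ card S * row_sum n k (?b n) (card S) / row_sum n k (?b n) 0 / lam ^ card S)
        \<longlonglongrightarrow> lam ^ card S * exp lam / exp lam / lam ^ card S"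
      using \<open>lam > 0\<close> by (intro tendsto_intros row_sum row_sum0) auto
    then have "(\<lambda>n. real n ^ card S * row_sum n k (?b n) (card S) / row_sum n k (?b n) 0
        / lam ^ card S) \<longlonglongrightarrow> 1"
      using \<open>lam > 0\<close> by simp
    moreover have "eventually (\<lambda>n. real n ^ card S * row_sum n k (?b n) (card S)
          / row_sum n k (?b n) 0 / lam ^ card S =
        measure_pmf.prob (P n) {X. \<forall>j\<in>S. X 1 j = 1}
          / (lam ^ card S * inverse (real n) ^ card S)) sequentially"
      \<comment> \<open>From here on \<open>{1..n}\<close> contains \<open>S\<close> and the source
        vertex 1; inserting 1 also keeps the maximum meaningful for empty \<open>S\<close>.\<close>
      using eventually_ge_at_top[of "Max (insert 1 S)"]
    proof eventually_elim
      case (elim n)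
      then have "1 \<in> {1..n}" "S \<subseteq> {1..n}"
        using that by (auto simp: Suc_le_eq intro!: gr0I)
      then show ?case
        unfolding P_def by (subst prob_ergm_edges) (auto simp: field_simps)
    qed
    ultimately show ?thesis
      by (auto intro: Lim_transform_eventually)
  qed
  have degree: "(\<lambda>n. measure_pmf.prob (P n) {X. out_degree n X v = d}) \<longlonglongrightarrow> pmf (poisson_pmf lam) d"
    if "v \<ge> 1" for v d
  proof -
    \<comment> \<open>The probability of degree \<open>d\<close> is expanded by
      \<open>n ^ d\<close>, which separates the limit \<open>1 / fact d\<close> of the binomial
      coefficient from the limit \<open>lam ^ d\<close> of the weight; \<open>n - 0\<close> is the
      case \<open>m = 0\<close> of \<open>tendsto_diff_choose\<close>.\<close>
    have "(\<lambda>n. real (n - 0 choose d) / real n ^ d * (real n ^ d * row_weight n k (?b n) d)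
        / row_sum n k (?b n) 0) \<longlonglongrightarrow> 1 / fact d * lam ^ d / exp lam"
      using assms sublinear
      by (intro tendsto_divide tendsto_mult tendsto_diff_choose row_weight_limit row_sum0) auto
    also have "1 / fact d * lam ^ d / exp lam = pmf (poisson_pmf lam) d"
      using \<open>lam > 0\<close> by (simp add: exp_minus field_simps)
    finally show ?thesis
    proof (rule Lim_transform_eventually)
      show "eventually (\<lambda>n. real (n - 0 choose d) / real n ^ d *
          (real n ^ d * row_weight n k (?b n) d) / row_sum n k (?b n) 0 =
          measure_pmf.prob (P n) {X. out_degree n X v = d}) sequentially"
        using eventually_ge_at_top[of v]
      proof eventually_elim
        case (elim n)
        with that have "v \<in> {1..n}" by simp
        then show ?case
          unfolding P_def by (subst prob_ergm_out_degree) auto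
      qed
    qed
  qed
  have "weak_conv_m (\<lambda>n. distr (measure_pmf (P n)) borel (\<lambda>X. real (out_degree n X v)))
      (distr (measure_pmf (poisson_pmf lam)) borel real)" if "v \<ge> 1" for v
  proof -
    \<comment> \<open>The distribution function of a variable with values in the naturals is, at
      each \<open>x\<close>, a finite sum of point masses (empty for \<open>x < 0\<close>).
      Convergence of the point masses thus gives convergence at every \<open>x\<close>, in
      particular at the continuity points.\<close>
    have cdf_eq: "cdf (distr (measure_pmf M) borel (\<lambda>X. real (f X))) x =
        (\<Sum>d\<in>{d. real d \<le> x}. measure_pmf.prob M {X. f X = d})" for M :: "'c pmf" and f x
    proof -
      have fin: "finite {d. real d \<le> x}"
        by (rule finite_subset[of _ "{..nat \<lfloor>x\<rfloor>}"]) (auto simp: le_nat_floor)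
      have "cdf (distr (measure_pmf M) borel (\<lambda>X. real (f X))) x =
          measure_pmf.prob M (\<Union>d\<in>{d. real d \<le> x}. {X. f X = d})"
        unfolding cdf_def by (subst measure_distr) (auto intro: arg_cong[where f = "measure M"])
      also have "\<dots> = (\<Sum>d\<in>{d. real d \<le> x}. measure_pmf.prob M {X. f X = d})"
        using fin by (intro measure_pmf.finite_measure_finite_Union)
          (auto simp: disjoint_family_on_def)
      finally show ?thesis .
    qed
    show ?thesis
      unfolding weak_conv_m_def weak_conv_def cdf_eq
      using degree[OF that] by (auto simp: pmf.rep_eq intro!: tendsto_sum)
  qed
  moreover have "(\<lambda>n. measure_pmf.prob (P n) {X. X 1 i = 1 \<and> X 1 j = 1}
      / (lam ^ 2 * inverse (real n) ^ 2)) \<longlonglongrightarrow> 1" if "i \<ge> 1" "j \<ge> 1" "i \<noteq> j" for i j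
    using edges[of "{i, j}"] that by (simp add: numeral_2_eq_2)
  moreover have "(\<lambda>n. measure_pmf.prob (P n) {X. X 1 i = 1} / (lam * inverse (real n)))
      \<longlonglongrightarrow> 1" if "i \<ge> 1" for i
    using edges[of "{i}"] that by simp
  ultimately show ?thesis by blast
qed

end
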